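(* Let $X$ be a (real) Hilbert space and let $Y$ be a real vector space. Let $a:X\times Y\to\mathbb{R}\cup\{+\infty\}$. Assume that for every $y\in Y$ the function $a(\cdot,y):X\to\mathbb{R}\cup\{+\infty\}$ is proper $\Phi_{lsc}$-convex on $X$ and for every $x\in X$ the function $a(x,\cdot):Y\to\mathbb{R}\cup\{+\infty\}$ is concave on $Y$. Suppose that for every $\alpha\in\mathbb{R}$ with $\alpha<\inf_{x\in X}\sup_{y\in Y}a(x,y)$ there exist $y_1,y_2\in Y$, $x_1\in\operatorname{dom}(a(\cdot,y_1))$, $x_2\in\operatorname{dom}(a(\cdot,y_2))$, $\varphi_1\in\partial_{\Phi_{lsc}}a(\cdot,y_1)(x_1)$ and $\varphi_2\in\partial_{\Phi_{lsc}}a(\cdot,y_2)(x_2)$ such that the intersection property holds for $\varphi_1$ and $\varphi_2$ on $X$ at the level $\alpha$. Then $$\sup_{y\in Y}\inf_{x\in X}a(x,y)=\inf_{x\in X}\sup_{y\in Y}a(x,y).$$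
   Context: $\Phi_{lsc}$ is the class of functions $\varphi:X\to\mathbb{R}$ of the form $\varphi(x)=-a\|x\|^2+\langle\ell,x\rangle+c$ with $a\ge0$, $\ell\in X^*$, $c\in\mathbb{R}$. For $f:X\to\mathbb{R}\cup\{+\infty\}$: $\operatorname{dom}(f):=\{x\in X:f(x)<+\infty\}$; $f$ is proper if $\operatorname{dom}(f)\ne\emptyset$; $\operatorname{supp}(f):=\{\varphi\in\Phi_{lsc}:\varphi(x)\le f(x)\ \forall x\in X\}$; $f$ is $\Phi_{lsc}$-convex if $\operatorname{supp}(f)\neq\emptyset$ and $f(x)=\sup\{\varphi(x):\varphi\in\operatorname{supp}(f)\}$ for all $x\in X$. For $\bar x\in\operatorname{dom}(f)$, the $\Phi_{lsc}$-subdifferential is $\partial_{\Phi_{lsc}}f(\bar x):=\{\varphi\in\operatorname{supp}(f):\ \varphi(\bar x)=f(\bar x)\}$. Functions $\varphi_1,\varphi_2:X\to\mathbb{R}$ have the intersection property on $X$ at the level $\alpha\in\mathbb{R}$ if $[\varphi_1<\alpha]\cap[\varphi_2<\alpha]=\emptyset$, where $[\varphi<\alpha]:=\{x\in X:\varphi(x)<\alpha\}$. *)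

theory Defs
  imports "HOL-Analysis.Analysis"
begin

text \<open>
  Functions with values in the extended half-line (reals together with plus infinity) are rendered
  as \<^typ>\<open>ereal\<close>-valued functions; theorems using them assume that the value
  minus infinity is not attained.  Suprema and infima are taken in \<^typ>\<open>ereal\<close>.
  The topological dual of \<open>'a\<close> is the type \<open>'a \<Rightarrow>\<^sub>L real\<close>
  of bounded linear functionals.
\<close>

definition Phi_lsc :: "('a::real_normed_vector \<Rightarrow> real) set" where
  "Phi_lsc = {\<phi>. \<exists>(a::real) (l :: 'a \<Rightarrow>\<^sub>L real) (c::real).
     a \<ge> 0 \<and> \<phi> = (\<lambda>x. - a * (norm x)\<^sup>2 + blinfun_apply l x + c)}"

definition dom_ext :: "('a \<Rightarrow> ereal) \<Rightarrow> 'a set" where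
  "dom_ext f = {x. f x < \<infinity>}"

definition proper_ext :: "('a \<Rightarrow> ereal) \<Rightarrow> bool" where
  "proper_ext f \<longleftrightarrow> dom_ext f \<noteq> {}"

definition supp_lsc :: "('a::real_normed_vector \<Rightarrow> ereal) \<Rightarrow> ('a \<Rightarrow> real) set" where
  "supp_lsc f = {\<phi> \<in> Phi_lsc. \<forall>x. ereal (\<phi> x) \<le> f x}"

definition Phi_lsc_convex :: "('a::real_normed_vector \<Rightarrow> ereal) \<Rightarrow> bool" where
  "Phi_lsc_convex f \<longleftrightarrow>
     supp_lsc f \<noteq> {} \<and> (\<forall>x. f x = (SUP \<phi>\<in>supp_lsc f. ereal (\<phi> x)))"

text \<open>Only meaningful at points of \<^term>\<open>dom_ext f\<close>.\<close>

definition subdiff_lsc ::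
    "('a::real_normed_vector \<Rightarrow> ereal) \<Rightarrow> 'a \<Rightarrow> ('a \<Rightarrow> real) set" where
  "subdiff_lsc f x = {\<phi> \<in> supp_lsc f. ereal (\<phi> x) = f x}"

definition intersection_property ::
    "('a \<Rightarrow> real) \<Rightarrow> ('a \<Rightarrow> real) \<Rightarrow> real \<Rightarrow> bool" where
  "intersection_property \<phi>1 \<phi>2 \<alpha> \<longleftrightarrow> {x. \<phi>1 x < \<alpha>} \<inter> {x. \<phi>2 x < \<alpha>} = {}"

text \<open>
  The library predicate \<^const>\<open>concave_on\<close> covers real-valued functions only.  For functions
  avoiding minus infinity the right-hand side below is never of the form infinity minus infinity,
  and restricting to weights strictly between 0 and 1 keeps products of 0 and infinity out.
\<close>

definition concave_ext :: "('b::real_vector \<Rightarrow> ereal) \<Rightarrow> bool" where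
  "concave_ext f \<longleftrightarrow>
     (\<forall>y z. \<forall>t::real. 0 < t \<and> t < 1 \<longrightarrow>
        ereal t * f y + ereal (1 - t) * f z \<le> f (t *\<^sub>R y + (1 - t) *\<^sub>R z))"

end

theory Submission
  imports Defs
begin

text \<open>
  The inequality \<open>sup inf \<le> inf sup\<close> always holds. For the converse it is enough to find, for each
  real \<open>\<alpha>\<close> below the right-hand side, a single \<open>y\<close> with \<open>a x y \<ge> \<alpha>\<close> for all \<open>x\<close>. The hypothesis
  supplies minorants \<open>\<phi>1 \<le> a(\<cdot>, y1)\<close> and \<open>\<phi>2 \<le> a(\<cdot>, y2)\<close>; if some convex combination
  \<open>t \<phi>1 + (1 - t) \<phi>2\<close> is at least \<open>\<alpha>\<close> everywhere, then concavity of \<open>a\<close> in \<open>y\<close> shows that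
  \<open>y = t y1 + (1 - t) y2\<close> will do.

  Thus everything rests on a theorem of the alternative (\<open>intersection_property_imp_convex_combination\<close>):
  two functions of \<open>\<Phi>\<^sub>l\<^sub>s\<^sub>c\<close> with disjoint strict sublevel sets have such a combination. This fails for
  general concave functions: on the real line, \<open>min x 1\<close> and \<open>min (- x) 1\<close> have disjoint
  sublevel sets at level 0, but every convex combination of them tends to minus infinity at plus
  or at minus infinity. For \<open>\<Phi>\<^sub>l\<^sub>s\<^sub>c\<close> it is a matter of growth. If neither sublevel set is empty, take \<open>u\<close> in the
  first and \<open>v\<close> in the second. By concavity, on the line through \<open>u\<close> and \<open>v\<close> the ray beyond \<open>u\<close>
  stays in the first set, hence outside the second, so \<open>\<phi>2\<close> is bounded below there; a function
  \<open>- a \<parallel>x\<parallel>\<^sup>2 + l x + c\<close> can only be bounded below on a ray if \<open>a = 0\<close>. Likewise for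
  \<open>\<phi>1\<close> beyond \<open>v\<close>. Both functions are therefore affine, and two disjoint open half-spaces have
  opposite normals, so suitable weights cancel the linear parts.
\<close>

section \<open>Concavity and growth along rays\<close>

lemma square_convex_combination_le:
  fixes p q t :: real
  assumes "0 \<le> t" "t \<le> 1"
  shows "(t * p + (1 - t) * q)\<^sup>2 \<le> t * p\<^sup>2 + (1 - t) * q\<^sup>2"
proof -
  have "t * p\<^sup>2 + (1 - t) * q\<^sup>2 - (t * p + (1 - t) * q)\<^sup>2 = t * (1 - t) * (p - q)\<^sup>2"
    by (simp add: power2_eq_square algebra_simps)
  moreover have "\<dots> \<ge> 0" using assms by simp
  ultimately show ?thesis by linarith
qed

lemma Phi_lsc_concave:
  assumes "\<phi> \<in> Phi_lsc" "0 \<le> t" "t \<le> 1"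
  shows "t * \<phi> x + (1 - t) * \<phi> y \<le> \<phi> (t *\<^sub>R x + (1 - t) *\<^sub>R y)"
proof -
  obtain a l c where a: "a \<ge> 0" and \<phi>: "\<phi> = (\<lambda>x. - a * (norm x)\<^sup>2 + blinfun_apply l x + c)"
    using assms(1) unfolding Phi_lsc_def by blast
  have "norm (t *\<^sub>R x + (1 - t) *\<^sub>R y) \<le> t * norm x + (1 - t) * norm y"
    using norm_triangle_ineq[of "t *\<^sub>R x" "(1 - t) *\<^sub>R y"] assms by simp
  then have "(norm (t *\<^sub>R x + (1 - t) *\<^sub>R y))\<^sup>2 \<le> (t * norm x + (1 - t) * norm y)\<^sup>2"
    by (intro power_mono) auto
  also have "\<dots> \<le> t * (norm x)\<^sup>2 + (1 - t) * (norm y)\<^sup>2"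
    using assms by (intro square_convex_combination_le) auto
  finally have "a * (norm (t *\<^sub>R x + (1 - t) *\<^sub>R y))\<^sup>2 \<le> a * (t * (norm x)\<^sup>2 + (1 - t) * (norm y)\<^sup>2)"
    using a by (rule mult_left_mono)
  then show ?thesis
    by (simp add: \<phi> blinfun.bilinear_simps algebra_simps)
qed

text \<open>
  The point \<open>u\<close> is the convex combination with weights \<open>1 / (1 + s)\<close> and \<open>s / (1 + s)\<close> of the point
  on the ray and \<open>v\<close>, so a value at least \<open>\<alpha>\<close> on the ray would force \<open>\<phi> u \<ge> \<alpha>\<close>.
\<close>

lemma Phi_lsc_less_beyond:
  assumes \<phi>: "\<phi> \<in> Phi_lsc" and u: "\<phi> u < \<alpha>" and v: "\<alpha> \<le> \<phi> v" and s: "0 \<le> s"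
  shows "\<phi> (u + s *\<^sub>R (u - v)) < \<alpha>"
proof -
  define t where "t = 1 / (1 + s)"
  let ?w = "u + s *\<^sub>R (u - v)"
  have t: "0 < t" "t \<le> 1" "1 - t = s * t"
    using s by (auto simp: t_def field_simps)
  have "t *\<^sub>R ?w + (1 - t) *\<^sub>R v = (t * (1 + s)) *\<^sub>R u"
    unfolding t(3) by (simp add: algebra_simps)
  also have "\<dots> = u" using s by (simp add: t_def)
  finally have "t * \<phi> ?w + (1 - t) * \<phi> v \<le> \<phi> u"
    using Phi_lsc_concave[OF \<phi>, of t ?w v] t by simp
  moreover have "(1 - t) * \<alpha> \<le> (1 - t) * \<phi> v"
    using v t by (intro mult_left_mono) auto
  ultimately have "t * \<phi> ?w < t * \<alpha>"
    using u by (simp add: algebra_simps)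
  then show ?thesis
    using t(1) by simp
qed

text \<open>
  Along a nonconstant ray the quadratic term beats the linear one. Since
  \<open>\<parallel>s d\<parallel>\<^sup>2 \<le> 2 \<parallel>u + s d\<parallel>\<^sup>2 + 2 \<parallel>u\<parallel>\<^sup>2\<close>, the function at \<open>u + s d\<close> exceeds \<open>\<alpha>\<close> by at most
  \<open>- k s\<^sup>2 + s (l d) + C\<close> with \<open>k = a \<parallel>d\<parallel>\<^sup>2 / 2\<close>, and \<open>s\<close> is chosen so that
  \<open>k s = k + \<bar>l d\<bar> + \<bar>C\<bar>\<close> dominates both remaining coefficients.
\<close>

lemma quadratic_unbounded_below_on_ray:
  fixes l :: "'a::real_normed_vector \<Rightarrow>\<^sub>L real"
  assumes a: "0 < a" and d: "d \<noteq> 0"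
  obtains s where "0 \<le> s"
    and "- a * (norm (u + s *\<^sub>R d))\<^sup>2 + blinfun_apply l (u + s *\<^sub>R d) + c < \<alpha>"
proof -
  define k where "k = a * (norm d)\<^sup>2 / 2"
  define C where "C = a * (norm u)\<^sup>2 + blinfun_apply l u + c - \<alpha>"
  define s where "s = 1 + (\<bar>blinfun_apply l d\<bar> + \<bar>C\<bar>) / k"
  have k: "k > 0" using a d by (simp add: k_def)
  have s1: "s \<ge> 1" using k by (simp add: s_def)
  have "norm (s *\<^sub>R d) \<le> norm (u + s *\<^sub>R d) + norm u"
    using norm_triangle_ineq4[of "u + s *\<^sub>R d" u] by simp
  then have "(norm (s *\<^sub>R d))\<^sup>2 \<le> (norm (u + s *\<^sub>R d) + norm u)\<^sup>2"
    by (intro power_mono) auto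
  also have "\<dots> \<le> 2 * (norm (u + s *\<^sub>R d))\<^sup>2 + 2 * (norm u)\<^sup>2"
    using square_convex_combination_le[of "1/2" "norm (u + s *\<^sub>R d)" "norm u"]
    by (simp add: power2_eq_square field_simps)
  finally have "s\<^sup>2 * (norm d)\<^sup>2 \<le> 2 * (norm (u + s *\<^sub>R d))\<^sup>2 + 2 * (norm u)\<^sup>2"
    by (simp add: power_mult_distrib)
  then have "a * (s\<^sup>2 * (norm d)\<^sup>2) \<le> a * (2 * (norm (u + s *\<^sub>R d))\<^sup>2 + 2 * (norm u)\<^sup>2)"
    using a by (intro mult_left_mono) auto
  then have quad: "k * s\<^sup>2 \<le> a * (norm (u + s *\<^sub>R d))\<^sup>2 + a * (norm u)\<^sup>2"
    by (simp add: k_def algebra_simps)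
  have "k * s = k + \<bar>blinfun_apply l d\<bar> + \<bar>C\<bar>"
    using k by (simp add: s_def field_simps)
  then have "k * s\<^sup>2 = s * (k + \<bar>blinfun_apply l d\<bar> + \<bar>C\<bar>)"
    by (simp add: power2_eq_square)
  then have "k * s\<^sup>2 = s * (k + \<bar>blinfun_apply l d\<bar>) + s * \<bar>C\<bar>"
    by (simp add: distrib_left)
  moreover have "s * blinfun_apply l d < s * (k + \<bar>blinfun_apply l d\<bar>)"
    using s1 k by (intro mult_strict_left_mono) linarith+
  moreover have "C \<le> s * \<bar>C\<bar>"
    using mult_right_mono[OF s1, of "\<bar>C\<bar>"] by linarith
  ultimately have "s * blinfun_apply l d + C < k * s\<^sup>2" by linarith
  with quad have "- a * (norm (u + s *\<^sub>R d))\<^sup>2 + blinfun_apply l (u + s *\<^sub>R d) + c < \<alpha>"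
    by (simp add: C_def blinfun.bilinear_simps)
  then show thesis using that[of s] s1 by simp
qed

text \<open>
  Beyond \<open>v\<close>, the function \<open>\<psi>\<close> stays below \<open>\<alpha>\<close>, so \<open>\<phi>\<close> is bounded below by \<open>\<alpha>\<close> on that ray.
\<close>

lemma Phi_lsc_affine_if_disjoint:
  assumes \<phi>: "\<phi> \<in> Phi_lsc" and \<psi>: "\<psi> \<in> Phi_lsc"
    and disj: "\<And>x. \<alpha> \<le> \<phi> x \<or> \<alpha> \<le> \<psi> x"
    and u: "\<phi> u < \<alpha>" and v: "\<psi> v < \<alpha>"
  obtains l c where "\<phi> = (\<lambda>x. blinfun_apply l x + c)"
proof -
  obtain a l c where a: "a \<ge> 0" and eq: "\<phi> = (\<lambda>x. - a * (norm x)\<^sup>2 + blinfun_apply l x + c)"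
    using \<phi> unfolding Phi_lsc_def by blast
  have \<psi>u: "\<alpha> \<le> \<psi> u" using disj[of u] u by auto
  have "a = 0"
  proof (rule ccontr)
    assume "a \<noteq> 0"
    moreover have "v - u \<noteq> 0" using \<psi>u v by auto
    ultimately obtain s where s: "0 \<le> s" "\<phi> (v + s *\<^sub>R (v - u)) < \<alpha>"
      using quadratic_unbounded_below_on_ray[of a "v - u" v l c \<alpha>] a unfolding eq by auto
    moreover have "\<psi> (v + s *\<^sub>R (v - u)) < \<alpha>"
      using Phi_lsc_less_beyond[OF \<psi> v \<psi>u s(1)] .
    ultimately show False using disj[of "v + s *\<^sub>R (v - u)"] by linarith
  qed
  then show thesis using that[of l c] eq by simp
qed

section \<open>The theorem of the alternative\<close>

text \<open>
  The points \<open>u\<close> and \<open>v\<close> show that \<open>l1\<close> and \<open>l2\<close> have opposite signs on \<open>v - u\<close>.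
  If the normals were not parallel, some direction \<open>y\<close> in the kernel of \<open>l1\<close> would change \<open>l2\<close>;
  moving \<open>u\<close> along \<open>y\<close> would then stay in the first half-space and reach the second.
\<close>

lemma disjoint_half_spaces_convex_combination:
  fixes l1 l2 :: "'a::real_normed_vector \<Rightarrow>\<^sub>L real"
  assumes disj: "\<And>x. \<alpha> \<le> blinfun_apply l1 x + c1 \<or> \<alpha> \<le> blinfun_apply l2 x + c2"
    and u: "blinfun_apply l1 u + c1 < \<alpha>" and v: "blinfun_apply l2 v + c2 < \<alpha>"
  obtains t where "0 < t" "t < 1"
    and "\<And>x. \<alpha> \<le> t * (blinfun_apply l1 x + c1) + (1 - t) * (blinfun_apply l2 x + c2)"
proof -
  define d where "d = v - u"
  define p where "p = blinfun_apply l1 d"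
  define q where "q = - blinfun_apply l2 d"
  have p: "p > 0" using disj[of v] u v by (simp add: p_def d_def blinfun.bilinear_simps)
  have q: "q > 0" using disj[of u] u v by (simp add: q_def d_def blinfun.bilinear_simps)
  have opposite: "q * blinfun_apply l1 x + p * blinfun_apply l2 x = 0" for x
  proof -
    define y where "y = x - (blinfun_apply l1 x / p) *\<^sub>R d"
    have l1y: "blinfun_apply l1 y = 0"
      using p by (simp add: y_def blinfun.bilinear_simps flip: p_def)
    have "blinfun_apply l2 y = 0"
    proof (rule ccontr)
      assume nz: "blinfun_apply l2 y \<noteq> 0"
      \<comment> \<open>The step length that brings the second function exactly to \<open>\<alpha> - 1\<close>.\<close>
      define s where "s = (\<alpha> - 1 - c2 - blinfun_apply l2 u) / blinfun_apply l2 y"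
      have "blinfun_apply l2 (u + s *\<^sub>R y) + c2 = \<alpha> - 1"
        using nz by (simp add: s_def blinfun.bilinear_simps)
      moreover have "blinfun_apply l1 (u + s *\<^sub>R y) + c1 < \<alpha>"
        using u l1y by (simp add: blinfun.bilinear_simps)
      ultimately show False using disj[of "u + s *\<^sub>R y"] by linarith
    qed
    then show ?thesis
      using p by (simp add: y_def q_def blinfun.bilinear_simps field_simps)
  qed
  \<comment> \<open>The weighted sum of the two functions minus \<open>\<alpha>\<close> is constant; were this constant negative,
    some multiple of \<open>d\<close> would split it evenly between the two terms, making both negative.\<close>
  define K where "K = q * (c1 - \<alpha>) + p * (c2 - \<alpha>)"
  have sum_eq: "q * (blinfun_apply l1 x + c1 - \<alpha>) + p * (blinfun_apply l2 x + c2 - \<alpha>) = K" for x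
    using opposite[of x] by (simp add: K_def algebra_simps)
  have "K \<ge> 0"
  proof (rule ccontr)
    assume "\<not> K \<ge> 0"
    define x where "x = ((K / (2 * q) + \<alpha> - c1) / p) *\<^sub>R d"
    have g1: "blinfun_apply l1 x + c1 - \<alpha> = K / (2 * q)"
      using p by (simp add: x_def blinfun.bilinear_simps flip: p_def)
    then have "p * (blinfun_apply l2 x + c2 - \<alpha>) = K / 2"
      using sum_eq[of x] q by (simp add: field_simps)
    then have "p * (blinfun_apply l2 x + c2 - \<alpha>) < 0"
      using \<open>\<not> K \<ge> 0\<close> by linarith
    then have "blinfun_apply l2 x + c2 - \<alpha> < 0"
      using p by (simp add: mult_less_0_iff)
    moreover have "blinfun_apply l1 x + c1 - \<alpha> < 0"
      unfolding g1 using q \<open>\<not> K \<ge> 0\<close> by (simp add: divide_less_0_iff)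
    ultimately show False using disj[of x] by linarith
  qed
  show thesis
  proof (rule that[of "q / (p + q)"])
    show "0 < q / (p + q)" "q / (p + q) < 1" using p q by auto
    fix x
    let ?A = "blinfun_apply l1 x + c1" and ?B = "blinfun_apply l2 x + c2"
    have "\<alpha> * (p + q) \<le> q * ?A + p * ?B"
      using sum_eq[of x] \<open>K \<ge> 0\<close> by (simp add: algebra_simps)
    then have "\<alpha> \<le> (q * ?A + p * ?B) / (p + q)"
      using p q by (simp add: pos_le_divide_eq)
    also have "\<dots> = q / (p + q) * ?A + p / (p + q) * ?B"
      by (simp add: add_divide_distrib)
    also have "p / (p + q) = 1 - q / (p + q)" using p q by (simp add: field_simps)
    finally show "\<alpha> \<le> q / (p + q) * ?A + (1 - q / (p + q)) * ?B" .
  qed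
qed

text \<open>
  The endpoints \<open>t = 0\<close> and \<open>t = 1\<close> occur when one of the two sublevel sets is empty.
\<close>

lemma intersection_property_imp_convex_combination:
  assumes \<phi>1: "\<phi>1 \<in> Phi_lsc" and \<phi>2: "\<phi>2 \<in> Phi_lsc"
    and ip: "intersection_property \<phi>1 \<phi>2 \<alpha>"
  obtains t where "0 \<le> t" "t \<le> 1" and "\<And>x. \<alpha> \<le> t * \<phi>1 x + (1 - t) * \<phi>2 x"
proof -
  have disj: "\<alpha> \<le> \<phi>1 x \<or> \<alpha> \<le> \<phi>2 x" for x
    using ip unfolding intersection_property_def by (auto simp: set_eq_iff not_less)
  consider "\<And>x. \<alpha> \<le> \<phi>1 x" | "\<And>x. \<alpha> \<le> \<phi>2 x" | u v where "\<phi>1 u < \<alpha>" "\<phi>2 v < \<alpha>"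
    by (meson not_le)
  then show thesis
  proof cases
    case 1
    then show ?thesis using that[of 1] by simp
  next
    case 2
    then show ?thesis using that[of 0] by simp
  next
    case (3 u v)
    have disj': "\<alpha> \<le> \<phi>2 x \<or> \<alpha> \<le> \<phi>1 x" for x using disj[of x] by blast
    obtain l1 c1 where e1: "\<phi>1 = (\<lambda>x. blinfun_apply l1 x + c1)"
      using Phi_lsc_affine_if_disjoint[OF \<phi>1 \<phi>2 disj 3] by blast
    obtain l2 c2 where e2: "\<phi>2 = (\<lambda>x. blinfun_apply l2 x + c2)"
      using Phi_lsc_affine_if_disjoint[OF \<phi>2 \<phi>1 disj' 3(2,1)] by blast
    obtain t where "0 < t" "t < 1" "\<And>x. \<alpha> \<le> t * \<phi>1 x + (1 - t) * \<phi>2 x"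
      using disjoint_half_spaces_convex_combination[OF disj[unfolded e1 e2] 3[unfolded e1 e2]]
      unfolding e1 e2 by blast
    then show ?thesis using that[of t] by simp
  qed
qed

section \<open>The minimax equality\<close>

lemma concave_ext_ge_minorants:
  assumes "concave_ext f" "0 \<le> t" "t \<le> 1" and r: "ereal r \<le> f y" and s: "ereal s \<le> f z"
  shows "ereal (t * r + (1 - t) * s) \<le> f (t *\<^sub>R y + (1 - t) *\<^sub>R z)"
proof -
  consider "t = 0" | "t = 1" | "0 < t" "t < 1" using assms by linarith
  then show ?thesis
  proof cases
    case 3
    have "ereal (t * r + (1 - t) * s) = ereal t * ereal r + ereal (1 - t) * ereal s" by simp
    also have "\<dots> \<le> ereal t * f y + ereal (1 - t) * f z"
      using 3 r s by (intro add_mono ereal_mult_left_mono) auto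
    also have "\<dots> \<le> f (t *\<^sub>R y + (1 - t) *\<^sub>R z)"
      using assms(1) 3 unfolding concave_ext_def by blast
    finally show ?thesis .
  qed (use r s in simp_all)
qed

theorem theorem6p1:
  fixes a :: "'x::{real_inner, complete_space} \<Rightarrow> 'y::real_vector \<Rightarrow> ereal"
  assumes not_MInf: "\<And>x y. a x y \<noteq> -\<infinity>"
    and proper: "\<And>y. proper_ext (\<lambda>x. a x y)"
    and lsc_convex: "\<And>y. Phi_lsc_convex (\<lambda>x. a x y)"
    and concave: "\<And>x. concave_ext (\<lambda>y. a x y)"
    and intersection:
      "\<And>\<alpha>::real. ereal \<alpha> < (INF x. SUP y. a x y) \<Longrightarrow>
         \<exists>y1 y2. \<exists>x1 \<in> dom_ext (\<lambda>x. a x y1). \<exists>x2 \<in> dom_ext (\<lambda>x. a x y2).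
           \<exists>\<phi>1 \<in> subdiff_lsc (\<lambda>x. a x y1) x1. \<exists>\<phi>2 \<in> subdiff_lsc (\<lambda>x. a x y2) x2.
             intersection_property \<phi>1 \<phi>2 \<alpha>"
  shows "(SUP y. INF x. a x y) = (INF x. SUP y. a x y)"
proof (rule antisym)
  show "(SUP y. INF x. a x y) \<le> (INF x. SUP y. a x y)"
    by (intro SUP_least INF_greatest) (meson INF_lower SUP_upper UNIV_I order_trans)
next
  have level: "ereal \<alpha> \<le> (SUP y. INF x. a x y)" if below: "ereal \<alpha> < (INF x. SUP y. a x y)" for \<alpha>
  proof -
    obtain y1 y2 x1 x2 \<phi>1 \<phi>2 where "\<phi>1 \<in> subdiff_lsc (\<lambda>x. a x y1) x1"
      and "\<phi>2 \<in> subdiff_lsc (\<lambda>x. a x y2) x2" and ip: "intersection_property \<phi>1 \<phi>2 \<alpha>"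
      using intersection[OF below] by blast
    then have \<phi>1: "\<phi>1 \<in> Phi_lsc" "\<And>x. ereal (\<phi>1 x) \<le> a x y1"
      and \<phi>2: "\<phi>2 \<in> Phi_lsc" "\<And>x. ereal (\<phi>2 x) \<le> a x y2"
      by (auto simp: subdiff_lsc_def supp_lsc_def)
    obtain t where t: "0 \<le> t" "t \<le> 1" and ge: "\<And>x. \<alpha> \<le> t * \<phi>1 x + (1 - t) * \<phi>2 x"
      using intersection_property_imp_convex_combination[OF \<phi>1(1) \<phi>2(1) ip] by blast
    let ?y = "t *\<^sub>R y1 + (1 - t) *\<^sub>R y2"
    have "ereal \<alpha> \<le> a x ?y" for x
    proof -
      have "ereal \<alpha> \<le> ereal (t * \<phi>1 x + (1 - t) * \<phi>2 x)" using ge[of x] by simp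
      also have "\<dots> \<le> a x ?y"
        using concave_ext_ge_minorants[OF concave t \<phi>1(2) \<phi>2(2)] .
      finally show ?thesis .
    qed
    then have "ereal \<alpha> \<le> (INF x. a x ?y)" by (intro INF_greatest)
    also have "\<dots> \<le> (SUP y. INF x. a x y)" by (intro SUP_upper) simp
    finally show ?thesis .
  qed
  show "(INF x. SUP y. a x y) \<le> (SUP y. INF x. a x y)"
  proof (rule ccontr)
    assume "\<not> ?thesis"
    then obtain \<alpha> where "(SUP y. INF x. a x y) < ereal \<alpha>" "ereal \<alpha> < (INF x. SUP y. a x y)"
      using ereal_dense2 by (metis not_le)
    with level[of \<alpha>] show False by simp
  qed
qed

end
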